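(* Let $\epsilon_1,\epsilon_2\in\mathbb{R}$. Suppose that in the quantum winning strategy for the Mermin-GHZ game Alice (player 1) performs both transformations $U$ and $H$ imperfectly with systematic errors $\epsilon_1$ and $\epsilon_2$, respectively (i.e. she applies $U_{\epsilon_1}$ in place of $U$ and $H_{\epsilon_2}$ in place of $H$), all other steps being performed correctly. Then for any inputs $x_1,x_2,x_3\in\{0,1\}$ satisfying the promise $x_1\oplus x_2\oplus x_3=0$, the strategy gives a correct answer with probability $$P_{\epsilon}(x_1,x_2,x_3)=\begin{cases}\frac12+\sin\left(\frac{\pi}{4}+\frac{\epsilon_2}{2}\right)\cos\left(\frac{\pi}{4}+\frac{\epsilon_2}{2}\right) & \text{if } x_1=0,\\[4pt] \frac12+\sin\left(\frac{\pi}{4}+\frac{\epsilon_2}{2}\right)\cos\left(\frac{\pi}{4}+\frac{\epsilon_2}{2}\right)\cos\epsilon_1 & \text{otherwise.}\end{cases}$$ Moreover, for a question $(x_1,x_2,x_3)$ chosen uniformly at random from the promise set $P$, it gives a correct answer with probability $$P_{\epsilon}=\frac12\left(1+\sin\left(\frac{\pi}{4}+\frac{\epsilon_2}{2}\right)\cos\left(\frac{\pi}{4}+\frac{\epsilon_2}{2}\right)(1+\cos\epsilon_1)\right).$$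
   Context: Mermin-GHZ game: three players, Alice, Bob and Charles (players 1, 2, 3), receive input bits $x_1,x_2,x_3\in\{0,1\}$ respectively, with the promise that $(x_1,x_2,x_3)\in P=\{(x_1,x_2,x_3)\in\{0,1\}^3 : x_1\oplus x_2\oplus x_3=0\}$. Without communicating, they output bits $a_1,a_2,a_3$ respectively. The answer is correct if $a_1\oplus a_2\oplus a_3=x_1\lor x_2\lor x_3$. Quantum winning strategy: the players share the three-qubit state $|\varphi\rangle=\frac{1}{\sqrt2}(|000\rangle+|111\rangle)$, player $i$ holding the $i$-th qubit. On input $x_i$, player $i$ (1) applies to his or her qubit the unitary $U$ given by $U|0\rangle=|0\rangle$, $U|1\rangle=e^{\pi \imath x_i/2}|1\rangle$; (2) applies the Hadamard transformation $H=\frac{1}{\sqrt2}\begin{pmatrix}1&1\\1&-1\end{pmatrix}$; (3) measures the qubit in the computational basis and outputs the measured bit $a_i$. Here $\imath$ is the imaginary unit. Systematic errors $\epsilon_1,\epsilon_2$ in Alice's transformations: $\epsilon_1,\epsilon_2$ are constants; in step (1) Alice applies instead of $U$ the unitary $U_{\epsilon_1}$ given by $U_{\epsilon_1}|0\rangle=|0\rangle$, $U_{\epsilon_1}|1\rangle=e^{(\frac{\pi}{2}+\epsilon_1)\imath x_1}|1\rangle$, and in step (2) she applies instead of $H$ the unitary $$H_{\epsilon_2}=\begin{pmatrix}\cos(\frac{\pi}{4}+\frac{\epsilon_2}{2}) & \sin(\frac{\pi}{4}+\frac{\epsilon_2}{2})\\ \sin(\frac{\pi}{4}+\frac{\epsilon_2}{2})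 & -\cos(\frac{\pi}{4}+\frac{\epsilon_2}{2})\end{pmatrix}$$ (matrix in the computational basis $|0\rangle,|1\rangle$); everything else is unchanged. *)

theory Defs
  imports "HOL-Probability.Probability"
begin

(* Bits are booleans, with 0 = False and 1 = True; the triple (b1, b2, b3) lists the bits of
   players 1, 2, 3 (Alice, Bob, Charles). *)

type_synonym bits3 = "bool \<times> bool \<times> bool"

abbreviation bxor :: "bool \<Rightarrow> bool \<Rightarrow> bool"  (infixl "\<oplus>" 65)
  where "a \<oplus> b \<equiv> a \<noteq> b"

definition ghz_promise :: "bits3 set"
  where "ghz_promise = {(x1, x2, x3). (x1 \<oplus> x2 \<oplus> x3) = False}"

definition ghz_correct :: "bits3 \<Rightarrow> bits3 \<Rightarrow> bool"
  where "ghz_correct = (\<lambda>(x1, x2, x3) (a1, a2, a3). (a1 \<oplus> a2 \<oplus> a3) = (x1 \<or> x2 \<or> x3))"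


(* Qubits are indexed by bool, so that axis b 1 is the basis vector |b>, and the three-qubit space
   by triples of bits, so that axis (b1, b2, b3) 1 is |b1 b2 b3>. *)

type_synonym gate = "complex ^ bool ^ bool"

definition mat2 :: "complex \<Rightarrow> complex \<Rightarrow> complex \<Rightarrow> complex \<Rightarrow> gate"
  where "mat2 a b c d =
    (\<chi> i j. if \<not> i then (if \<not> j then a else b) else (if \<not> j then c else d))"

definition kron :: "complex ^ 'n ^ 'm \<Rightarrow> complex ^ 'q ^ 'p \<Rightarrow> complex ^ ('n \<times> 'q) ^ ('m \<times> 'p)"
    (infixr "\<otimes>" 70)
  where "A \<otimes> B = (\<chi> i j. A $ fst i $ fst j * B $ snd i $ snd j)"

definition ghz_state :: "complex ^ bits3"
  where "ghz_state =
    (1 / sqrt 2) *\<^sub>R (axis (False, False, False) 1 + axis (True, True, True) 1)"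

(* Joint measurement of all qubits in the computational basis (Born rule).  For a unit vector the
   weights sum to 1, so embed_pmf is well defined; see pmf_measure_comp_basis. *)
definition measure_comp_basis :: "complex ^ 'n \<Rightarrow> 'n::finite pmf"
  where "measure_comp_basis \<psi> = embed_pmf (\<lambda>a. (cmod (\<psi> $ a))\<^sup>2)"

lemma pmf_measure_comp_basis:
  assumes "norm \<psi> = 1"
  shows "pmf (measure_comp_basis \<psi>) a = (cmod (\<psi> $ a))\<^sup>2"
proof -
  have "(\<Sum>a\<in>UNIV. (cmod (\<psi> $ a))\<^sup>2) = 1"
    using assms by (simp add: norm_vec_def L2_set_def)
  then have "(\<integral>\<^sup>+ a. ennreal ((cmod (\<psi> $ a))\<^sup>2) \<partial>count_space UNIV) = 1"
    by (simp add: nn_integral_count_space_finite sum_ennreal)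
  then show ?thesis
    unfolding measure_comp_basis_def by (simp add: pmf_embed_pmf)
qed


definition phase_gate :: "bool \<Rightarrow> gate"
  where "phase_gate x = mat2 1 0 0 (exp (pi * \<i> * of_bool x / 2))"

definition hadamard :: gate
  where "hadamard = (1 / sqrt 2) *\<^sub>R mat2 1 1 1 (- 1)"

definition phase_gate_err :: "real \<Rightarrow> bool \<Rightarrow> gate"
  where "phase_gate_err \<epsilon> x = mat2 1 0 0 (exp ((pi / 2 + \<epsilon>) * \<i> * of_bool x))"

definition hadamard_err :: "real \<Rightarrow> gate"
  where "hadamard_err \<epsilon> =
    mat2 (cos (pi / 4 + \<epsilon> / 2)) (sin (pi / 4 + \<epsilon> / 2))
         (sin (pi / 4 + \<epsilon> / 2)) (- cos (pi / 4 + \<epsilon> / 2))"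

(* The distribution of the players' outputs as a function of their inputs, when Alice uses UA and HA
   for her two transformations and Bob and Charles follow the protocol exactly; the error-free
   winning strategy is ghz_strategy phase_gate hadamard. *)
definition ghz_strategy :: "(bool \<Rightarrow> gate) \<Rightarrow> gate \<Rightarrow> bits3 \<Rightarrow> bits3 pmf"
  where "ghz_strategy UA HA = (\<lambda>(x1, x2, x3).
    measure_comp_basis
      ((HA \<otimes> hadamard \<otimes> hadamard) *v
        ((UA x1 \<otimes> phase_gate x2 \<otimes> phase_gate x3) *v ghz_state)))"

definition ghz_imperfect_strategy :: "real \<Rightarrow> real \<Rightarrow> bits3 \<Rightarrow> bits3 pmf"
  where "ghz_imperfect_strategy \<epsilon>1 \<epsilon>2 = ghz_strategy (phase_gate_err \<epsilon>1) (hadamard_err \<epsilon>2)"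

definition success_prob :: "(bits3 \<Rightarrow> bits3 pmf) \<Rightarrow> bits3 \<Rightarrow> real"
  where "success_prob S x = measure_pmf.prob (S x) {a. ghz_correct x a}"

definition uniform_success_prob :: "(bits3 \<Rightarrow> bits3 pmf) \<Rightarrow> real"
  where "uniform_success_prob S =
    measure_pmf.prob
      (bind_pmf (pmf_of_set ghz_promise) (\<lambda>x. map_pmf (\<lambda>a. (x, a)) (S x)))
      {(x, a). ghz_correct x a}"

end

(* The phase gates turn the shared state into (|000> + z |111>) / sqrt 2 with |z| = 1, and after the
   Hadamard gates the output (a1, a2, a3) has weight (1 + (-1)^(a1+a2+a3) 2 sin \<theta> cos \<theta> Re z) / 8,
   where \<theta> = \<pi>/4 + \<epsilon>2/2.  On the promise set, z = 1 for the input (0,0,0), z = -1 for (0,1,1), and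
   z = -exp(i \<epsilon>1) if x1 = 1; in each case four outputs have the required parity, namely even for
   (0,0,0) and odd otherwise. *)

theory Submission
  imports Defs
begin

text \<open>The parameter \<open>z\<close> collects the product of the three phases, so that one
  family holds the state both before and after the phase gates.\<close>

definition phased_ghz_state :: "complex \<Rightarrow> complex ^ bits3"
  where "phased_ghz_state z =
    (1 / sqrt 2) *\<^sub>R (axis (False, False, False) 1 + z *s axis (True, True, True) 1)"

lemma ghz_state_eq: "ghz_state = phased_ghz_state 1"
  by (simp add: ghz_state_def phased_ghz_state_def)

lemma phased_ghz_state_nth:
  "phased_ghz_state z $ b = complex_of_real (1 / sqrt 2) *
    ((if b = (False, False, False) then 1 else 0) + (if b = (True, True, True) then z else 0))"
  by (simp add: phased_ghz_state_def axis_def scaleR_conv_of_real [where 'a = complex])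

text \<open>Only two coordinates of the state can be nonzero, so just two columns of
  \<open>M\<close> contribute.\<close>

lemma matrix_vector_mult_phased_ghz_state:
  "(M *v phased_ghz_state z) $ k =
    complex_of_real (1 / sqrt 2) * (M $ k $ (False, False, False) + z * M $ k $ (True, True, True))"
proof -
  have "(M *v phased_ghz_state z) $ k = (\<Sum>b\<in>UNIV. complex_of_real (1 / sqrt 2) *
      ((if b = (False, False, False) then M $ k $ b else 0) +
       (if b = (True, True, True) then z * M $ k $ b else 0)))"
    unfolding matrix_vector_mult_def phased_ghz_state_nth vec_lambda_beta
    by (rule sum.cong) auto
  then show ?thesis
    unfolding sum_distrib_left [symmetric] sum.distrib by simp
qed

lemma mat2_nth:
  "mat2 a b c d $ i $ j = (if \<not> i then (if \<not> j then a else b) else (if \<not> j then c else d))"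
  by (simp add: mat2_def)

text \<open>The product gate is diagonal: it fixes |000> and multiplies |111> by all three
  phases.\<close>

lemma phases_ghz_state:
  "(mat2 1 0 0 p \<otimes> mat2 1 0 0 q \<otimes> mat2 1 0 0 r) *v ghz_state = phased_ghz_state (p * q * r)"
  unfolding vec_eq_iff ghz_state_eq matrix_vector_mult_phased_ghz_state phased_ghz_state_nth
  by (auto simp: kron_def mat2_nth)

text \<open>The two exact Hadamard gates contribute a factor 1/2 and, in the |111> term, the sign
  (-1)^(a2+a3). The gate \<open>H\<close> stays arbitrary, to be instantiated by Alice's imperfect
  one.\<close>

lemma hadamards_amplitude:
  "((H \<otimes> hadamard \<otimes> hadamard) *v phased_ghz_state z) $ (a1, a2, a3) =
   complex_of_real (1 / (2 * sqrt 2)) *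
     (H $ a1 $ False + (if a2 \<oplus> a3 then - 1 else 1) * z * H $ a1 $ True)"
proof -
  have "complex_of_real (sqrt 2) * complex_of_real (sqrt 2) = 2"
    by (simp flip: of_real_mult)
  then show ?thesis
    by (simp add: matrix_vector_mult_phased_ghz_state kron_def hadamard_def mat2_nth
        scaleR_conv_of_real [where 'a = complex] field_simps)
qed

lemma cmod_add_unit_mult_sq:
  fixes a b :: real
  assumes "cmod z = 1"
  shows "(cmod (of_real a + z * of_real b))\<^sup>2 = a\<^sup>2 + b\<^sup>2 + 2 * a * b * Re z"
proof -
  have "(Re z)\<^sup>2 + (Im z)\<^sup>2 = 1"
    using assms by (simp flip: cmod_power2)
  then show ?thesis
    unfolding cmod_power2 by simp algebra
qed

text \<open>Each row of \<open>hadamard_err\<close> is a real unit vector, and the product of its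
  entries is sin \<theta> cos \<theta> up to the sign (-1)^a1. This sign joins the one from
  \<open>a2\<close> and \<open>a3\<close> in the cross term of the squared modulus.\<close>

lemma hadamard_err_weight:
  assumes "cmod z = 1"
  shows "(cmod (((hadamard_err \<epsilon> \<otimes> hadamard \<otimes> hadamard) *v phased_ghz_state z) $ (a1, a2, a3)))\<^sup>2 =
   (1 + (if a1 \<oplus> a2 \<oplus> a3 then - 1 else 1) *
      (2 * sin (pi / 4 + \<epsilon> / 2) * cos (pi / 4 + \<epsilon> / 2) * Re z)) / 8"
proof -
  \<comment> \<open>Absorbing the sign into \<open>z\<close> keeps the modulus 1, as
    \<open>cmod_add_unit_mult_sq\<close> requires.\<close>
  define w where "w = (if a2 \<oplus> a3 then - 1 else 1) * z"
  have w: "cmod w = 1" "Re w = (if a2 \<oplus> a3 then - 1 else 1) * Re z"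
    using assms by (auto simp: w_def)
  define \<theta> where "\<theta> = pi / 4 + \<epsilon> / 2"
  let ?a = "if a1 then sin \<theta> else cos \<theta>" and ?b = "if a1 then - cos \<theta> else sin \<theta>"
  have "hadamard_err \<epsilon> $ a1 $ False = of_real ?a" "hadamard_err \<epsilon> $ a1 $ True = of_real ?b"
    by (simp_all add: hadamard_err_def mat2_nth \<theta>_def flip: cos_of_real sin_of_real)
  moreover have "?a\<^sup>2 + ?b\<^sup>2 = 1"
    by simp
  ultimately show ?thesis
    unfolding hadamards_amplitude w_def [symmetric] \<theta>_def [symmetric]
    using w(2) cmod_add_unit_mult_sq [OF w(1), of ?a ?b]
    by (auto simp: norm_mult norm_divide power_mult_distrib power_divide)
qed

lemma phase_gate_err_eq: "phase_gate_err \<epsilon> x = mat2 1 0 0 (if x then \<i> * cis \<epsilon> else 1)"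
proof -
  have "exp ((pi / 2 + \<epsilon>) * \<i>) = cis (pi / 2 + \<epsilon>)"
    by (simp add: cis_conv_exp mult.commute)
  then show ?thesis
    by (simp add: phase_gate_err_def flip: cis_mult)
qed

lemma phase_gate_eq: "phase_gate x = mat2 1 0 0 (if x then \<i> else 1)"
  \<comment> \<open>The exact gate is the case of error 0.\<close>
  using phase_gate_err_eq [of 0 x] by (simp add: phase_gate_def phase_gate_err_def mult.commute)

lemma pmf_ghz_imperfect_strategy:
  fixes \<epsilon>1 \<epsilon>2 :: real
  defines "phase x1 x2 x3 \<equiv>
    (if x1 then \<i> * cis \<epsilon>1 else 1) * (if x2 then \<i> else 1) * (if x3 then \<i> else 1)"
  shows "pmf (ghz_imperfect_strategy \<epsilon>1 \<epsilon>2 (x1, x2, x3)) (a1, a2, a3) =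
   (1 + (if a1 \<oplus> a2 \<oplus> a3 then - 1 else 1) *
      (2 * sin (pi / 4 + \<epsilon>2 / 2) * cos (pi / 4 + \<epsilon>2 / 2) * Re (phase x1 x2 x3))) / 8"
proof -
  let ?z = "phase x1 x2 x3"
  let ?\<psi> = "(hadamard_err \<epsilon>2 \<otimes> hadamard \<otimes> hadamard) *v phased_ghz_state ?z"
  have z: "cmod ?z = 1"
    by (simp add: phase_def norm_mult)
  \<comment> \<open>Normalisation comes from the weights rather than from unitarity of the gates:
    four outputs have each parity, so the signed terms cancel.\<close>
  have "(\<Sum>a\<in>UNIV. (cmod (?\<psi> $ a))\<^sup>2) = 1"
    by (simp add: UNIV_Times_UNIV [symmetric] sum.cartesian_product' UNIV_bool
        hadamard_err_weight [OF z] field_simps del: UNIV_Times_UNIV)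
  then have "norm ?\<psi> = 1"
    by (simp add: norm_vec_def L2_set_def)
  then have "pmf (measure_comp_basis ?\<psi>) (a1, a2, a3) = (cmod (?\<psi> $ (a1, a2, a3)))\<^sup>2"
    by (rule pmf_measure_comp_basis)
  then show ?thesis
    by (simp only: ghz_imperfect_strategy_def ghz_strategy_def prod.case phase_gate_eq
        phase_gate_err_eq phases_ghz_state phase_def [symmetric] hadamard_err_weight [OF z])
qed

lemma ghz_promise_eq:
  "ghz_promise = {(False, False, False), (False, True, True), (True, False, True), (True, True, False)}"
  by (auto simp: ghz_promise_def)

lemma success_prob_imperfect:
  assumes "(x1, x2, x3) \<in> ghz_promise"
  shows "success_prob (ghz_imperfect_strategy \<epsilon>1 \<epsilon>2) (x1, x2, x3) =
    1 / 2 + sin (pi / 4 + \<epsilon>2 / 2) * cos (pi / 4 + \<epsilon>2 / 2) * (if x1 then cos \<epsilon>1 else 1)"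
proof -
  \<comment> \<open>For the all-zero question the correct answers are the triples of even parity,
    which form the same set as the promise.\<close>
  have "{a. ghz_correct (x1, x2, x3) a} =
      (if x1 \<or> x2 \<or> x3
       then {(True, False, False), (False, True, False), (False, False, True), (True, True, True)}
       else ghz_promise)"
    by (auto simp: ghz_correct_def ghz_promise_eq)
  then show ?thesis
    using assms
    by (auto simp: success_prob_def measure_measure_pmf_finite pmf_ghz_imperfect_strategy
        ghz_promise_eq field_simps)
qed

text \<open>This is the law of total probability, conditioning on the question.\<close>

lemma uniform_success_prob_eq:
  "uniform_success_prob S = (\<Sum>x\<in>ghz_promise. success_prob S x) / card ghz_promise"
proof -
  have fin: "finite ghz_promise" "ghz_promise \<noteq> {}"
    by (auto simp: ghz_promise_eq)
  have "uniform_success_prob S =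
      measure_pmf.expectation (pmf_of_set ghz_promise) (success_prob S)"
    by (simp add: uniform_success_prob_def success_prob_def [abs_def] measure_pmf_bind vimage_def
        measure_pmf.measure_bind [where N = "count_space UNIV"] measure_subprob)
  also have "\<dots> = (\<Sum>x\<in>ghz_promise. success_prob S x) / card ghz_promise"
    using fin by (simp add: integral_pmf_of_set)
  finally show ?thesis .
qed

theorem theorem5:
  fixes \<epsilon>1 \<epsilon>2 :: real
  shows
    "(\<forall>x1 x2 x3. (x1, x2, x3) \<in> ghz_promise \<longrightarrow>
        success_prob (ghz_imperfect_strategy \<epsilon>1 \<epsilon>2) (x1, x2, x3) =
          (if x1 = False
           then 1 / 2 + sin (pi / 4 + \<epsilon>2 / 2) * cos (pi / 4 + \<epsilon>2 / 2)
           else 1 / 2 + sin (pi / 4 + \<epsilon>2 / 2) * cos (pi / 4 + \<epsilon>2 / 2) * cos \<epsilon>1)) \<and>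
     uniform_success_prob (ghz_imperfect_strategy \<epsilon>1 \<epsilon>2) =
       1 / 2 * (1 + sin (pi / 4 + \<epsilon>2 / 2) * cos (pi / 4 + \<epsilon>2 / 2) * (1 + cos \<epsilon>1))"
proof -
  \<comment> \<open>Two of the four questions have \<open>x1 = False\<close> and two have
    \<open>x1 = True\<close>.\<close>
  have "(\<Sum>x\<in>ghz_promise. success_prob (ghz_imperfect_strategy \<epsilon>1 \<epsilon>2) x) =
      2 * (1 + sin (pi / 4 + \<epsilon>2 / 2) * cos (pi / 4 + \<epsilon>2 / 2) * (1 + cos \<epsilon>1))"
    by (simp add: ghz_promise_eq success_prob_imperfect algebra_simps)
  moreover have "card ghz_promise = 4"
    by (simp add: ghz_promise_eq)
  ultimately show ?thesis
    by (simp add: success_prob_imperfect uniform_success_prob_eq)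
qed

end
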